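(* Let $(\tilde X,\tilde d,E)$ and $(\tilde Y,\tilde\rho,E')$ be soft metric spaces, and let $(f,\varphi):(\tilde X,\tilde d,E)\to(\tilde Y,\tilde\rho,E')$ be a soft mapping, given by maps $f:X\to Y$ and $\varphi:E\to E'$. Then the following conditions are equivalent: (1) $(f,\varphi)$ is a soft continuous mapping; (2) for each soft open set $(G,E')$ over $Y$, $(f,\varphi)^{-1}((G,E'))$ is a soft open set over $X$; (3) for each soft closed set $(H,E')$ over $Y$, $(f,\varphi)^{-1}((H,E'))$ is a soft closed set over $X$; (4) for each soft set $(F,E)$ over $X$, $(f,\varphi)\big(\overline{(F,E)}\big)\subset\overline{(f,\varphi)(F,E)}$; (5) for each soft set $(G,E')$ over $Y$, $\overline{(f,\varphi)^{-1}(G,E')}\subset(f,\varphi)^{-1}\big(\overline{(G,E')}\big)$; (6) for each soft set $(G,E')$ over $Y$, $(f,\varphi)^{-1}\big((G,E')^\circ\big)\subset\big((f,\varphi)^{-1}(G,E')\big)^\circ$.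
   Context: Let $X$ be a set and $E$ a set of parameters (similarly $Y$, $E'$). A soft set $(F,E)$ over $X$ is a map $F:E\to P(X)$; inclusion, union, intersection and complement of soft sets are taken parameterwise. $\tilde X$ is the absolute soft set ($e\mapsto X$). For $x\in X$, $\lambda\in E$, the soft point $\tilde x_\lambda$ is the soft set $P$ with $P(\lambda)=\{x\}$ and $P(e)=\emptyset$ for $e\ne\lambda$. Thus $\tilde x_\lambda=\tilde y_\mu$ iff $x=y$ and $\lambda=\mu$. $SP(\tilde X)$ is the set of all soft points; $\tilde x_\lambda\tilde\in(F,E)$ means $x\in F(\lambda)$. A soft set is identified with the collection of soft points belonging to it. A soft real number (over $E$) is a function $\tilde r:E\to\mathbb R$. Order is parameterwise: $\tilde r\,\tilde\le\,\tilde s$ iff $\tilde r(e)\le\tilde s(e)$ for all $e$, and $\tilde r\,\tilde<\,\tilde s$ iff $\tilde r(e)<\tilde s(e)$ for all $e$; arithmetic is also parameterwise. $\bar0$ is the constant function $0$, and $\mathbb R(E)^*$ is the set of non-negative soft real numbers. A soft metric on $\tilde X$ is a map $\tilde d:SP(\tilde X)\times SP(\tilde X)\to\mathbb R(E)^*$ such that for all soft points: $\tilde d(\tilde x_\lambda,\tilde y_\mu)\,\tilde\ge\,\bar0$; $\tilde d(\tilde x_\lambda,\tilde y_\mu)=\bar0$ iff $\tilde x_\lambda=\tilde y_\mu$; $\tilde d(\tilde x_\lambda,\tilde y_\mu)=\tilde d(\tilde y_\mu,\tilde x_\lambda)$; $\tilde d(\tilde x_\lambda,\tilde z_\nu)\,\tilde\le\,\tilde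 d(\tilde x_\lambda,\tilde y_\mu)+\tilde d(\tilde y_\mu,\tilde z_\nu)$. Then $(\tilde X,\tilde d,E)$ is a soft metric space; $(\tilde Y,\tilde\rho,E')$ is defined likewise, with $\tilde\rho$ valued in $\mathbb R(E')^*$. The soft open ball is $B(\tilde x_\lambda,\tilde\varepsilon)=\{\tilde y_\mu\in SP(\tilde X):\tilde d(\tilde x_\lambda,\tilde y_\mu)\,\tilde<\,\tilde\varepsilon\}$. A soft set is soft open if for each of its soft points $\tilde x_\lambda$ there is a soft real number $\tilde\varepsilon\,\tilde>\,\bar0$ with $B(\tilde x_\lambda,\tilde\varepsilon)$ contained in it (the null soft set is soft open); it is soft closed if its complement is soft open. The soft interior $(F,E)^\circ$ is the union of all soft open sets contained in $(F,E)$; the soft closure $\overline{(F,E)}$ is the intersection of all soft closed sets containing $(F,E)$. For the soft mapping $(f,\varphi)$, the image of $(F,E)$ is the soft set over $Y$ given by $(f,\varphi)(F,E)(e')=\bigcup_{e\in\varphi^{-1}(e')}f(F(e))$ for $e'\in E'$ (so $(f,\varphi)(\tilde x_\lambda)$ is the soft point $\widetilde{f(x)}_{\varphi(\lambda)}$), and the inverse image of $(G,E')$ is the soft set over $X$ given by $(f,\varphi)^{-1}(G,E')(e)=f^{-1}(G(\varphi(e)))$ for $e\in E$. $(f,\varphi)$ is soft continuous at $\tilde x_\lambda$ if for every soft real number $\tilde\varepsilon\,\tilde>\,\bar0$ (over $E'$) there is a soft real number $\tilde\delta\,\tilde>\,\bar0$ (over $E$) such that $\tilde d(\tilde x_\lambda,\tilde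 y_\mu)\,\tilde<\,\tilde\delta$ implies $\tilde\rho((f,\varphi)(\tilde x_\lambda),(f,\varphi)(\tilde y_\mu))\,\tilde<\,\tilde\varepsilon$, i.e. $(f,\varphi)(B(\tilde x_\lambda,\tilde\delta))\subset B((f,\varphi)(\tilde x_\lambda),\tilde\varepsilon)$. It is soft continuous if it is soft continuous at every soft point of $\tilde X$. *)

theory Defs
  imports Complex_Main "HOL-Library.FuncSet"
begin

text \<open>
  The universe \<open>X\<close> and the parameter set \<open>E\<close> are arbitrary (possibly empty) carrier sets.
  Maps defined on \<open>E\<close> are represented extensionally (value \<open>undefined\<close> outside \<open>E\<close>), so that
  HOL equality of soft sets, soft points and soft real numbers is equality of maps on \<open>E\<close>.
\<close>

type_synonym ('e, 'a) soft_set = "'e \<Rightarrow> 'a set"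

definition soft_sets :: "'e set \<Rightarrow> 'a set \<Rightarrow> ('e, 'a) soft_set set" where
  "soft_sets E X = (E \<rightarrow>\<^sub>E Pow X)"

definition soft_subset :: "'e set \<Rightarrow> ('e, 'a) soft_set \<Rightarrow> ('e, 'a) soft_set \<Rightarrow> bool" where
  "soft_subset E F G \<longleftrightarrow> (\<forall>e\<in>E. F e \<subseteq> G e)"

definition soft_compl :: "'e set \<Rightarrow> 'a set \<Rightarrow> ('e, 'a) soft_set \<Rightarrow> ('e, 'a) soft_set" where
  "soft_compl E X F = (\<lambda>e\<in>E. X - F e)"

definition soft_Union :: "'e set \<Rightarrow> ('e, 'a) soft_set set \<Rightarrow> ('e, 'a) soft_set" where
  "soft_Union E \<F> = (\<lambda>e\<in>E. \<Union>F\<in>\<F>. F e)"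

definition soft_Inter :: "'e set \<Rightarrow> ('e, 'a) soft_set set \<Rightarrow> ('e, 'a) soft_set" where
  "soft_Inter E \<F> = (\<lambda>e\<in>E. \<Inter>F\<in>\<F>. F e)"

definition soft_point :: "'e set \<Rightarrow> 'a \<Rightarrow> 'e \<Rightarrow> ('e, 'a) soft_set" where
  "soft_point E x l = (\<lambda>e\<in>E. if e = l then {x} else {})"

definition SP :: "'e set \<Rightarrow> 'a set \<Rightarrow> ('e, 'a) soft_set set" where
  "SP E X = {soft_point E x l |x l. x \<in> X \<and> l \<in> E}"

text \<open>The collection of soft points with which a soft set is identified.\<close>

definition points_of :: "'e set \<Rightarrow> ('e, 'a) soft_set \<Rightarrow> ('e, 'a) soft_set set" where
  "points_of E F = {soft_point E x l |x l. l \<in> E \<and> x \<in> F l}"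

type_synonym 'e soft_real = "'e \<Rightarrow> real"

definition soft_reals :: "'e set \<Rightarrow> 'e soft_real set" where
  "soft_reals E = (E \<rightarrow>\<^sub>E UNIV)"

definition soft_le :: "'e set \<Rightarrow> 'e soft_real \<Rightarrow> 'e soft_real \<Rightarrow> bool" where
  "soft_le E r s \<longleftrightarrow> (\<forall>e\<in>E. r e \<le> s e)"

definition soft_less :: "'e set \<Rightarrow> 'e soft_real \<Rightarrow> 'e soft_real \<Rightarrow> bool" where
  "soft_less E r s \<longleftrightarrow> (\<forall>e\<in>E. r e < s e)"

definition soft_zero :: "'e set \<Rightarrow> 'e soft_real" where
  "soft_zero E = (\<lambda>e\<in>E. 0)"

definition soft_add :: "'e set \<Rightarrow> 'e soft_real \<Rightarrow> 'e soft_real \<Rightarrow> 'e soft_real" where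
  "soft_add E r s = (\<lambda>e\<in>E. r e + s e)"

definition nonneg_soft_reals :: "'e set \<Rightarrow> 'e soft_real set" where
  "nonneg_soft_reals E = {r \<in> soft_reals E. soft_le E (soft_zero E) r}"

definition pos_soft_reals :: "'e set \<Rightarrow> 'e soft_real set" where
  "pos_soft_reals E = {r \<in> soft_reals E. soft_less E (soft_zero E) r}"

type_synonym ('e, 'a) soft_dist = "('e, 'a) soft_set \<Rightarrow> ('e, 'a) soft_set \<Rightarrow> 'e soft_real"

definition soft_metric_space :: "'e set \<Rightarrow> 'a set \<Rightarrow> ('e, 'a) soft_dist \<Rightarrow> bool" where
  "soft_metric_space E X d \<longleftrightarrow>
     (\<forall>P\<in>SP E X. \<forall>Q\<in>SP E X. d P Q \<in> nonneg_soft_reals E) \<and>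
     (\<forall>P\<in>SP E X. \<forall>Q\<in>SP E X. d P Q = soft_zero E \<longleftrightarrow> P = Q) \<and>
     (\<forall>P\<in>SP E X. \<forall>Q\<in>SP E X. d P Q = d Q P) \<and>
     (\<forall>P\<in>SP E X. \<forall>Q\<in>SP E X. \<forall>R\<in>SP E X.
        soft_le E (d P R) (soft_add E (d P Q) (d Q R)))"

definition soft_ball ::
    "'e set \<Rightarrow> 'a set \<Rightarrow> ('e, 'a) soft_dist \<Rightarrow> ('e, 'a) soft_set \<Rightarrow> 'e soft_real
      \<Rightarrow> ('e, 'a) soft_set set" where
  "soft_ball E X d P \<epsilon> = {Q \<in> SP E X. soft_less E (d P Q) \<epsilon>}"

definition soft_open :: "'e set \<Rightarrow> 'a set \<Rightarrow> ('e, 'a) soft_dist \<Rightarrow> ('e, 'a) soft_set \<Rightarrow> bool" where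
  "soft_open E X d F \<longleftrightarrow> F \<in> soft_sets E X \<and>
     (\<forall>P\<in>points_of E F. \<exists>\<epsilon>\<in>pos_soft_reals E. soft_ball E X d P \<epsilon> \<subseteq> points_of E F)"

definition soft_closed :: "'e set \<Rightarrow> 'a set \<Rightarrow> ('e, 'a) soft_dist \<Rightarrow> ('e, 'a) soft_set \<Rightarrow> bool" where
  "soft_closed E X d F \<longleftrightarrow> F \<in> soft_sets E X \<and> soft_open E X d (soft_compl E X F)"

definition soft_interior ::
    "'e set \<Rightarrow> 'a set \<Rightarrow> ('e, 'a) soft_dist \<Rightarrow> ('e, 'a) soft_set \<Rightarrow> ('e, 'a) soft_set" where
  "soft_interior E X d F = soft_Union E {U. soft_open E X d U \<and> soft_subset E U F}"

text \<open>
  For a soft set over \<open>X\<close>, the family being intersected contains the absolute soft set,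
  so the intersection is never taken over an empty family.
\<close>

definition soft_closure ::
    "'e set \<Rightarrow> 'a set \<Rightarrow> ('e, 'a) soft_dist \<Rightarrow> ('e, 'a) soft_set \<Rightarrow> ('e, 'a) soft_set" where
  "soft_closure E X d F = soft_Inter E {C. soft_closed E X d C \<and> soft_subset E F C}"

definition soft_mapping ::
    "'e set \<Rightarrow> 'a set \<Rightarrow> 'p set \<Rightarrow> 'b set \<Rightarrow> ('a \<Rightarrow> 'b) \<Rightarrow> ('e \<Rightarrow> 'p) \<Rightarrow> bool" where
  "soft_mapping E X E' Y f \<phi> \<longleftrightarrow> f \<in> X \<rightarrow> Y \<and> \<phi> \<in> E \<rightarrow> E'"

definition soft_image ::
    "'e set \<Rightarrow> 'p set \<Rightarrow> ('a \<Rightarrow> 'b) \<Rightarrow> ('e \<Rightarrow> 'p) \<Rightarrow> ('e, 'a) soft_set \<Rightarrow> ('p, 'b) soft_set" where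
  "soft_image E E' f \<phi> F = (\<lambda>e'\<in>E'. \<Union>e\<in>{e \<in> E. \<phi> e = e'}. f ` F e)"

definition soft_vimage ::
    "'e set \<Rightarrow> 'a set \<Rightarrow> ('a \<Rightarrow> 'b) \<Rightarrow> ('e \<Rightarrow> 'p) \<Rightarrow> ('p, 'b) soft_set \<Rightarrow> ('e, 'a) soft_set" where
  "soft_vimage E X f \<phi> G = (\<lambda>e\<in>E. {x \<in> X. f x \<in> G (\<phi> e)})"

definition soft_continuous_at ::
    "'e set \<Rightarrow> 'a set \<Rightarrow> ('e, 'a) soft_dist \<Rightarrow> 'p set \<Rightarrow> ('p, 'b) soft_dist
      \<Rightarrow> ('a \<Rightarrow> 'b) \<Rightarrow> ('e \<Rightarrow> 'p) \<Rightarrow> ('e, 'a) soft_set \<Rightarrow> bool" where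
  "soft_continuous_at E X d E' \<rho> f \<phi> P \<longleftrightarrow>
     (\<forall>\<epsilon>\<in>pos_soft_reals E'. \<exists>\<delta>\<in>pos_soft_reals E. \<forall>Q\<in>SP E X.
        soft_less E (d P Q) \<delta> \<longrightarrow>
        soft_less E' (\<rho> (soft_image E E' f \<phi> P) (soft_image E E' f \<phi> Q)) \<epsilon>)"

definition soft_continuous ::
    "'e set \<Rightarrow> 'a set \<Rightarrow> ('e, 'a) soft_dist \<Rightarrow> 'p set \<Rightarrow> ('p, 'b) soft_dist
      \<Rightarrow> ('a \<Rightarrow> 'b) \<Rightarrow> ('e \<Rightarrow> 'p) \<Rightarrow> bool" where
  "soft_continuous E X d E' \<rho> f \<phi> \<longleftrightarrow>
     (\<forall>P\<in>SP E X. soft_continuous_at E X d E' \<rho> f \<phi> P)"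

end

theory Submission
  imports Defs
begin

text \<open>
  Soft open sets are stable under unions, and soft open balls are soft open because the radius
  can be shrunk separately at every parameter.  The equivalences are then the usual topological
  ones; the cycle used is (3), (5), (4), (3), together with the pairs (1)-(2), (2)-(3), (2)-(6).
\<close>

section \<open>Soft sets and soft points as extensional maps\<close>

lemma soft_sets_eqI:
  assumes "F \<in> soft_sets E X" "G \<in> soft_sets E X" "soft_subset E F G" "soft_subset E G F"
  shows "F = G"
  \<comment> \<open>Off \<open>E\<close> both maps are \<open>undefined\<close>, so the two
    parameterwise inclusions are enough for HOL equality.\<close>
  using assms unfolding soft_sets_def soft_subset_def by (intro PiE_ext) auto

lemma soft_sets_memD: "F \<in> soft_sets E X \<Longrightarrow> l \<in> E \<Longrightarrow> x \<in> F l \<Longrightarrow> x \<in> X"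
  unfolding soft_sets_def by auto

lemma soft_subset_refl: "soft_subset E F F"
  unfolding soft_subset_def by blast

lemma soft_subset_trans: "soft_subset E F G \<Longrightarrow> soft_subset E G H \<Longrightarrow> soft_subset E F H"
  unfolding soft_subset_def by blast

text \<open>Evaluate both maps at \<open>l\<close>: the left value is \<open>{x}\<close>, and the
  right value is nonempty only if \<open>l = m\<close>, in which case it is
  \<open>{y}\<close>.\<close>

lemma soft_point_inject:
  assumes "l \<in> E"
  shows "soft_point E x l = soft_point E y m \<longleftrightarrow> x = y \<and> l = m"
proof
  assume "soft_point E x l = soft_point E y m"
  then have "soft_point E x l l = soft_point E y m l" by simp
  then show "x = y \<and> l = m" using assms by (simp add: soft_point_def split: if_splits)
qed simp

lemma soft_point_in_SP: "x \<in> X \<Longrightarrow> l \<in> E \<Longrightarrow> soft_point E x l \<in> SP E X"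
  unfolding SP_def by blast

lemma soft_point_in_points_of: "l \<in> E \<Longrightarrow> soft_point E x l \<in> points_of E F \<longleftrightarrow> x \<in> F l"
  unfolding points_of_def by (auto simp: soft_point_inject)

text \<open>Trades soft points, which are functions, for pairs of a parameter and an element; the
  later openness arguments run on this form. The translation rests on
  \<open>soft_point_in_points_of\<close>, hence on injectivity of soft points.\<close>

lemma soft_open_iff:
  "soft_open E X d F \<longleftrightarrow> F \<in> soft_sets E X \<and>
     (\<forall>l\<in>E. \<forall>x\<in>F l. \<exists>\<epsilon>\<in>pos_soft_reals E. \<forall>m\<in>E. \<forall>y\<in>X.
        soft_less E (d (soft_point E x l) (soft_point E y m)) \<epsilon> \<longrightarrow> y \<in> F m)"
proof -
  have ball: "soft_ball E X d P \<epsilon> \<subseteq> points_of E F \<longleftrightarrow>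
      (\<forall>m\<in>E. \<forall>y\<in>X. soft_less E (d P (soft_point E y m)) \<epsilon> \<longrightarrow> y \<in> F m)" for P \<epsilon>
  proof -
    have "soft_ball E X d P \<epsilon> \<subseteq> points_of E F \<longleftrightarrow>
        (\<forall>m\<in>E. \<forall>y\<in>X. soft_less E (d P (soft_point E y m)) \<epsilon> \<longrightarrow>
           soft_point E y m \<in> points_of E F)"
      unfolding soft_ball_def SP_def by blast
    then show ?thesis by (simp add: soft_point_in_points_of)
  qed
  have "(\<forall>P\<in>points_of E F. R P) \<longleftrightarrow> (\<forall>l\<in>E. \<forall>x\<in>F l. R (soft_point E x l))" for R
    unfolding points_of_def by blast
  then show ?thesis unfolding soft_open_def ball by simp
qed

section \<open>Soft open and soft closed sets\<close>

lemma soft_open_in_sets: "soft_open E X d F \<Longrightarrow> F \<in> soft_sets E X"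
  by (simp add: soft_open_iff)

lemma soft_closed_in_sets: "soft_closed E X d F \<Longrightarrow> F \<in> soft_sets E X"
  by (simp add: soft_closed_def)

lemma soft_open_Union:
  assumes "\<And>U. U \<in> \<U> \<Longrightarrow> soft_open E X d U"
  shows "soft_open E X d (soft_Union E \<U>)"
  unfolding soft_open_iff
proof (intro conjI ballI)
  show "soft_Union E \<U> \<in> soft_sets E X"
    using soft_open_in_sets[OF assms] unfolding soft_sets_def soft_Union_def by fastforce
next
  fix l x
  assume l: "l \<in> E" and "x \<in> soft_Union E \<U> l"
  then obtain U where U: "U \<in> \<U>" "x \<in> U l" by (auto simp: soft_Union_def)
  obtain \<epsilon> where "\<epsilon> \<in> pos_soft_reals E" and
      "\<forall>m\<in>E. \<forall>y\<in>X. soft_less E (d (soft_point E x l) (soft_point E y m)) \<epsilon> \<longrightarrow> y \<in> U m"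
    using assms[OF U(1)] l U(2) unfolding soft_open_iff by meson
  then show "\<exists>\<epsilon>\<in>pos_soft_reals E. \<forall>m\<in>E. \<forall>y\<in>X.
      soft_less E (d (soft_point E x l) (soft_point E y m)) \<epsilon> \<longrightarrow> y \<in> soft_Union E \<U> m"
    using U(1) by (intro bexI[of _ \<epsilon>]) (auto simp: soft_Union_def)
qed

lemma soft_compl_in_sets: "soft_compl E X F \<in> soft_sets E X"
  unfolding soft_compl_def soft_sets_def by auto

lemma soft_compl_compl: "F \<in> soft_sets E X \<Longrightarrow> soft_compl E X (soft_compl E X F) = F"
  by (intro soft_sets_eqI[OF soft_compl_in_sets])
    (auto simp: soft_subset_def soft_compl_def dest: soft_sets_memD)

lemma soft_closed_compl_iff:
  "F \<in> soft_sets E X \<Longrightarrow> soft_closed E X d (soft_compl E X F) \<longleftrightarrow> soft_open E X d F"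
  by (simp add: soft_closed_def soft_compl_in_sets soft_compl_compl)

lemma soft_open_empty: "soft_open E X d (\<lambda>e\<in>E. {})"
  by (auto simp: soft_open_iff soft_sets_def)

lemma soft_closed_absolute: "soft_closed E X d (\<lambda>e\<in>E. X)"
proof -
  have "soft_compl E X (\<lambda>e\<in>E. X) = (\<lambda>e\<in>E. {})"
    unfolding soft_compl_def by (rule restrict_ext) simp
  then show ?thesis
    using soft_open_empty[of E X d] by (simp add: soft_closed_def soft_sets_def)
qed

text \<open>De Morgan reduces this to unions of soft open sets. Some member must exist to keep the
  intersection inside \<open>X\<close>: over an empty family every parameter would get
  \<open>UNIV\<close>.\<close>

lemma soft_closed_Inter:
  assumes "\<And>C. C \<in> \<C> \<Longrightarrow> soft_closed E X d C" and "\<C> \<noteq> {}"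
  shows "soft_closed E X d (soft_Inter E \<C>)"
  unfolding soft_closed_def
proof
  obtain C where C: "C \<in> \<C>" using assms(2) by blast
  then have "\<And>e. e \<in> E \<Longrightarrow> C e \<subseteq> X"
    using soft_closed_in_sets[OF assms(1)] by (auto dest: soft_sets_memD)
  then show "soft_Inter E \<C> \<in> soft_sets E X"
    using C unfolding soft_sets_def soft_Inter_def by fastforce
  have "soft_compl E X (soft_Inter E \<C>) = soft_Union E (soft_compl E X ` \<C>)"
    unfolding soft_compl_def soft_Union_def soft_Inter_def by (rule restrict_ext) auto
  then show "soft_open E X d (soft_compl E X (soft_Inter E \<C>))"
    using assms(1) by (auto simp: soft_closed_def intro!: soft_open_Union)
qed

section \<open>Soft interior and soft closure\<close>

lemma soft_open_interior: "soft_open E X d (soft_interior E X d F)"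
  unfolding soft_interior_def by (rule soft_open_Union) simp

lemma soft_interior_subset: "soft_subset E (soft_interior E X d F) F"
  by (auto simp: soft_interior_def soft_subset_def soft_Union_def)

lemma soft_interior_maximal:
  "soft_open E X d U \<Longrightarrow> soft_subset E U F \<Longrightarrow> soft_subset E U (soft_interior E X d F)"
  by (auto simp: soft_interior_def soft_subset_def soft_Union_def)

lemma soft_interior_eq:
  "soft_open E X d F \<Longrightarrow> soft_interior E X d F = F"
  by (intro soft_sets_eqI[of _ E X] soft_interior_subset soft_interior_maximal soft_subset_refl
      soft_open_in_sets[OF soft_open_interior] soft_open_in_sets)

lemma soft_closed_closure:
  assumes "F \<in> soft_sets E X"
  shows "soft_closed E X d (soft_closure E X d F)"
proof -
  \<comment> \<open>The absolute soft set is closed and contains \<open>F\<close>, so the family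
    defining the closure is nonempty.\<close>
  have "soft_subset E F (\<lambda>e\<in>E. X)"
    using assms by (auto simp: soft_subset_def dest: soft_sets_memD)
  then show ?thesis
    unfolding soft_closure_def using soft_closed_absolute[of E X d]
    by (intro soft_closed_Inter) auto
qed

lemma soft_subset_closure: "soft_subset E F (soft_closure E X d F)"
  by (auto simp: soft_closure_def soft_subset_def soft_Inter_def)

lemma soft_closure_minimal:
  "soft_closed E X d C \<Longrightarrow> soft_subset E F C \<Longrightarrow> soft_subset E (soft_closure E X d F) C"
  by (auto simp: soft_closure_def soft_subset_def soft_Inter_def)

lemma soft_closure_mono:
  assumes "soft_subset E F G" "G \<in> soft_sets E X"
  shows "soft_subset E (soft_closure E X d F) (soft_closure E X d G)"
  by (intro soft_closure_minimal soft_closed_closure assms(2)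
      soft_subset_trans[OF assms(1) soft_subset_closure])

text \<open>A set always lies in its closure, so the reverse inclusion makes it equal to a closed
  set. This is how closedness is recovered from condition (4).\<close>

lemma soft_closed_if_closure_subset:
  assumes "F \<in> soft_sets E X" "soft_subset E (soft_closure E X d F) F"
  shows "soft_closed E X d F"
proof -
  have "soft_closure E X d F = F"
    using assms soft_closed_closure[OF assms(1), of d]
    by (intro soft_sets_eqI[of _ E X] soft_subset_closure) (auto dest: soft_closed_in_sets)
  then show ?thesis using soft_closed_closure[OF assms(1), of d] by simp
qed

section \<open>Soft open balls\<close>

lemma soft_open_ball:
  assumes "soft_metric_space E X d" "x \<in> X" "l \<in> E"
  shows "soft_open E X d (\<lambda>m\<in>E. {y \<in> X. soft_less E (d (soft_point E x l) (soft_point E y m)) \<epsilon>})"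
    (is "soft_open E X d ?B")
  unfolding soft_open_iff
proof (intro conjI ballI)
  \<comment> \<open>\<open>soft_ball\<close> is a collection of soft points; \<open>?B\<close> is
    the soft set with exactly those points, so that it can later be pulled back along a soft
    mapping.\<close>
  show "?B \<in> soft_sets E X" by (auto simp: soft_sets_def)
next
  fix m y
  assume m: "m \<in> E" and "y \<in> ?B m"
  then have y: "y \<in> X" "soft_less E (d (soft_point E x l) (soft_point E y m)) \<epsilon>" by auto
  \<comment> \<open>The slack left by the distance from the centre to \<open>y\<close> at
    \<open>m\<close>, taken at each parameter. Since the soft order is strict at every parameter,
    all values are positive.\<close>
  let ?\<delta> = "\<lambda>e\<in>E. \<epsilon> e - d (soft_point E x l) (soft_point E y m) e"
  have "?\<delta> \<in> pos_soft_reals E"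
    using y(2) by (simp add: pos_soft_reals_def soft_reals_def soft_less_def soft_zero_def)
  moreover have "z \<in> ?B n"
    if "n \<in> E" "z \<in> X" and less: "soft_less E (d (soft_point E y m) (soft_point E z n)) ?\<delta>" for n z
  proof -
    \<comment> \<open>Triangle inequality through \<open>y\<close> at \<open>m\<close>; with
      \<open>?\<delta>\<close> bounding the second summand, the total stays below
      \<open>\<epsilon>\<close> at every parameter.\<close>
    have "soft_le E (d (soft_point E x l) (soft_point E z n))
        (soft_add E (d (soft_point E x l) (soft_point E y m)) (d (soft_point E y m) (soft_point E z n)))"
      using assms that(1,2) m y(1) unfolding soft_metric_space_def by (blast intro: soft_point_in_SP)
    then have "soft_less E (d (soft_point E x l) (soft_point E z n)) \<epsilon>"
      using less by (fastforce simp: soft_le_def soft_less_def soft_add_def)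
    then show ?thesis using that(1,2) by simp
  qed
  ultimately show "\<exists>\<delta>\<in>pos_soft_reals E. \<forall>n\<in>E. \<forall>z\<in>X.
      soft_less E (d (soft_point E y m) (soft_point E z n)) \<delta> \<longrightarrow> z \<in> ?B n" by blast
qed

lemma soft_metric_refl:
  assumes "soft_metric_space E X d" "x \<in> X" "l \<in> E"
  shows "d (soft_point E x l) (soft_point E x l) = soft_zero E"
  using assms unfolding soft_metric_space_def by (blast intro: soft_point_in_SP)

section \<open>Images and inverse images under a soft mapping\<close>

lemma soft_image_point:
  assumes "l \<in> E"
  shows "soft_image E E' f \<phi> (soft_point E x l) = soft_point E' (f x) (\<phi> l)"
  unfolding soft_image_def soft_point_def[of E']
proof (rule restrict_ext)
  fix e' assume "e' \<in> E'"
  \<comment> \<open>Only \<open>e = l\<close> contributes to the union, and \<open>l\<close> lies in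
    the fibre over \<open>e'\<close> exactly when \<open>e' = \<phi> l\<close>.\<close>
  show "(\<Union>e\<in>{e \<in> E. \<phi> e = e'}. f ` soft_point E x l e) = (if e' = \<phi> l then {f x} else {})"
    using assms by (auto simp: soft_point_def split: if_splits)
qed

text \<open>Puts continuity in the same pairwise form as \<open>soft_open_iff\<close>, so that radii
  can be passed directly between the two.\<close>

lemma soft_continuous_iff:
  "soft_continuous E X d E' \<rho> f \<phi> \<longleftrightarrow>
     (\<forall>l\<in>E. \<forall>x\<in>X. \<forall>\<epsilon>\<in>pos_soft_reals E'. \<exists>\<delta>\<in>pos_soft_reals E. \<forall>m\<in>E. \<forall>y\<in>X.
        soft_less E (d (soft_point E x l) (soft_point E y m)) \<delta> \<longrightarrow>
        soft_less E' (\<rho> (soft_point E' (f x) (\<phi> l)) (soft_point E' (f y) (\<phi> m))) \<epsilon>)"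
proof -
  have "(\<forall>P\<in>SP E X. R P) \<longleftrightarrow> (\<forall>l\<in>E. \<forall>x\<in>X. R (soft_point E x l))" for R
    unfolding SP_def by blast
  then show ?thesis
    unfolding soft_continuous_def soft_continuous_at_def by (simp add: soft_image_point)
qed

lemma soft_vimage_in_sets: "soft_vimage E X f \<phi> G \<in> soft_sets E X"
  unfolding soft_vimage_def soft_sets_def by auto

lemma soft_vimage_mono:
  "soft_mapping E X E' Y f \<phi> \<Longrightarrow> soft_subset E' G H \<Longrightarrow>
    soft_subset E (soft_vimage E X f \<phi> G) (soft_vimage E X f \<phi> H)"
  unfolding soft_vimage_def soft_subset_def soft_mapping_def by auto

text \<open>Holds because \<open>f\<close> sends \<open>X\<close> into \<open>Y\<close> and
  \<open>\<phi>\<close> sends \<open>E\<close> into \<open>E'\<close>: a point of \<open>X\<close>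
  then avoids the inverse image of \<open>G\<close> exactly when its image lies in the complement
  taken in \<open>Y\<close>.\<close>

lemma soft_vimage_compl:
  assumes "soft_mapping E X E' Y f \<phi>"
  shows "soft_vimage E X f \<phi> (soft_compl E' Y G) = soft_compl E X (soft_vimage E X f \<phi> G)"
  unfolding soft_vimage_def soft_compl_def
  using assms by (intro restrict_ext) (auto simp: soft_mapping_def)

lemma soft_image_in_sets:
  assumes "soft_mapping E X E' Y f \<phi>" "F \<in> soft_sets E X"
  shows "soft_image E E' f \<phi> F \<in> soft_sets E' Y"
  using assms unfolding soft_image_def soft_sets_def soft_mapping_def by fastforce

text \<open>The adjunction between image and inverse image: both sides say that
  \<open>f x \<in> G (\<phi> e)\<close> whenever \<open>e \<in> E\<close> and
  \<open>x \<in> F e\<close>. It moves inclusions between the two spaces in the steps around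
  (4).\<close>

lemma soft_image_subset_iff:
  assumes "soft_mapping E X E' Y f \<phi>" "F \<in> soft_sets E X"
  shows "soft_subset E' (soft_image E E' f \<phi> F) G \<longleftrightarrow> soft_subset E F (soft_vimage E X f \<phi> G)"
  using assms soft_sets_memD[OF assms(2)]
  unfolding soft_subset_def soft_image_def soft_vimage_def soft_mapping_def by fastforce

section \<open>Continuity in terms of inverse images of soft open sets\<close>

lemma soft_continuous_iff_open_vimage:
  assumes "soft_metric_space E X d" "soft_metric_space E' Y \<rho>" "soft_mapping E X E' Y f \<phi>"
  shows "soft_continuous E X d E' \<rho> f \<phi> \<longleftrightarrow>
    (\<forall>G. soft_open E' Y \<rho> G \<longrightarrow> soft_open E X d (soft_vimage E X f \<phi> G))"
proof (intro iffI allI impI)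
  fix G
  assume cont: "soft_continuous E X d E' \<rho> f \<phi>" and G: "soft_open E' Y \<rho> G"
  show "soft_open E X d (soft_vimage E X f \<phi> G)"
    unfolding soft_open_iff
  proof (intro conjI soft_vimage_in_sets ballI)
    fix l x
    assume l: "l \<in> E" and "x \<in> soft_vimage E X f \<phi> G l"
    then have x: "x \<in> X" "f x \<in> G (\<phi> l)" by (auto simp: soft_vimage_def)
    have "\<phi> l \<in> E'" using assms(3) l by (auto simp: soft_mapping_def)
    \<comment> \<open>Openness of \<open>G\<close> at the image point supplies
      \<open>\<epsilon>\<close>; continuity then turns it into a radius \<open>\<delta>\<close> for
      the inverse image.\<close>
    then obtain \<epsilon> where \<epsilon>: "\<epsilon> \<in> pos_soft_reals E'" and
        ball: "\<And>m y. m \<in> E' \<Longrightarrow> y \<in> Y \<Longrightarrow>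
          soft_less E' (\<rho> (soft_point E' (f x) (\<phi> l)) (soft_point E' y m)) \<epsilon> \<Longrightarrow> y \<in> G m"
      using G x(2) unfolding soft_open_iff by meson
    obtain \<delta> where \<delta>: "\<delta> \<in> pos_soft_reals E" and
        "\<And>m y. m \<in> E \<Longrightarrow> y \<in> X \<Longrightarrow> soft_less E (d (soft_point E x l) (soft_point E y m)) \<delta> \<Longrightarrow>
          soft_less E' (\<rho> (soft_point E' (f x) (\<phi> l)) (soft_point E' (f y) (\<phi> m))) \<epsilon>"
      using cont l x(1) \<epsilon> unfolding soft_continuous_iff by meson
    then show "\<exists>\<delta>\<in>pos_soft_reals E. \<forall>m\<in>E. \<forall>y\<in>X.
        soft_less E (d (soft_point E x l) (soft_point E y m)) \<delta> \<longrightarrow> y \<in> soft_vimage E X f \<phi> G m"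
      using ball assms(3) by (intro bexI[OF _ \<delta>]) (simp add: soft_vimage_def soft_mapping_def Pi_iff)
  qed
next
  assume vim: "\<forall>G. soft_open E' Y \<rho> G \<longrightarrow> soft_open E X d (soft_vimage E X f \<phi> G)"
  show "soft_continuous E X d E' \<rho> f \<phi>"
    unfolding soft_continuous_iff
  proof (intro ballI)
    fix l x \<epsilon>
    assume l: "l \<in> E" and x: "x \<in> X" and \<epsilon>: "\<epsilon> \<in> pos_soft_reals E'"
    have \<phi>: "\<And>m. m \<in> E \<Longrightarrow> \<phi> m \<in> E'" and f: "\<And>y. y \<in> X \<Longrightarrow> f y \<in> Y"
      using assms(3) by (auto simp: soft_mapping_def)
    \<comment> \<open>The test set is the ball of radius \<open>\<epsilon>\<close> about the image
      point; a ball around \<open>x\<close> at \<open>l\<close> inside its inverse image is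
      precisely what continuity asks for.\<close>
    let ?G = "\<lambda>m\<in>E'. {y \<in> Y. soft_less E' (\<rho> (soft_point E' (f x) (\<phi> l)) (soft_point E' y m)) \<epsilon>}"
    have G: "soft_open E X d (soft_vimage E X f \<phi> ?G)"
      using vim soft_open_ball[OF assms(2) f[OF x] \<phi>[OF l]] by blast
    \<comment> \<open>The centre has distance \<open>soft_zero E'\<close> from itself and
      \<open>\<epsilon>\<close> is positive, so \<open>x\<close> at \<open>l\<close> lies in the
      inverse image of the ball.\<close>
    have "soft_less E' (\<rho> (soft_point E' (f x) (\<phi> l)) (soft_point E' (f x) (\<phi> l))) \<epsilon>"
      using \<epsilon> by (simp add: soft_metric_refl[OF assms(2) f[OF x] \<phi>[OF l]] pos_soft_reals_def)
    then have "x \<in> soft_vimage E X f \<phi> ?G l"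
      using l x \<phi> f by (simp add: soft_vimage_def)
    then obtain \<delta> where \<delta>: "\<delta> \<in> pos_soft_reals E" and
        "\<And>m y. m \<in> E \<Longrightarrow> y \<in> X \<Longrightarrow> soft_less E (d (soft_point E x l) (soft_point E y m)) \<delta> \<Longrightarrow>
          y \<in> soft_vimage E X f \<phi> ?G m"
      using G l unfolding soft_open_iff by meson
    then show "\<exists>\<delta>\<in>pos_soft_reals E. \<forall>m\<in>E. \<forall>y\<in>X.
        soft_less E (d (soft_point E x l) (soft_point E y m)) \<delta> \<longrightarrow>
        soft_less E' (\<rho> (soft_point E' (f x) (\<phi> l)) (soft_point E' (f y) (\<phi> m))) \<epsilon>"
      using \<phi> by (intro bexI[OF _ \<delta>]) (simp add: soft_vimage_def)
  qed
qed

section \<open>Equivalence of the six conditions\<close>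

theorem theorem4p3:
  fixes E :: "'e set" and X :: "'a set" and d :: "('e, 'a) soft_dist"
    and E' :: "'p set" and Y :: "'b set" and \<rho> :: "('p, 'b) soft_dist"
    and f :: "'a \<Rightarrow> 'b" and \<phi> :: "'e \<Rightarrow> 'p"
  assumes "soft_metric_space E X d"
    and "soft_metric_space E' Y \<rho>"
    and "soft_mapping E X E' Y f \<phi>"
  shows
    "(soft_continuous E X d E' \<rho> f \<phi> \<longleftrightarrow>
        (\<forall>G\<in>soft_sets E' Y. soft_open E' Y \<rho> G \<longrightarrow> soft_open E X d (soft_vimage E X f \<phi> G))) \<and>
     (soft_continuous E X d E' \<rho> f \<phi> \<longleftrightarrow>
        (\<forall>H\<in>soft_sets E' Y. soft_closed E' Y \<rho> H \<longrightarrow> soft_closed E X d (soft_vimage E X f \<phi> H))) \<and>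
     (soft_continuous E X d E' \<rho> f \<phi> \<longleftrightarrow>
        (\<forall>F\<in>soft_sets E X. soft_subset E' (soft_image E E' f \<phi> (soft_closure E X d F))
                                          (soft_closure E' Y \<rho> (soft_image E E' f \<phi> F)))) \<and>
     (soft_continuous E X d E' \<rho> f \<phi> \<longleftrightarrow>
        (\<forall>G\<in>soft_sets E' Y. soft_subset E (soft_closure E X d (soft_vimage E X f \<phi> G))
                                          (soft_vimage E X f \<phi> (soft_closure E' Y \<rho> G)))) \<and>
     (soft_continuous E X d E' \<rho> f \<phi> \<longleftrightarrow>
        (\<forall>G\<in>soft_sets E' Y. soft_subset E (soft_vimage E X f \<phi> (soft_interior E' Y \<rho> G))
                                          (soft_interior E X d (soft_vimage E X f \<phi> G))))"
proof -
  note map = assms(3)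
  let ?inv = "soft_vimage E X f \<phi>"
  let ?C1 = "soft_continuous E X d E' \<rho> f \<phi>"
  let ?C2 = "\<forall>G\<in>soft_sets E' Y. soft_open E' Y \<rho> G \<longrightarrow> soft_open E X d (?inv G)"
  let ?C3 = "\<forall>H\<in>soft_sets E' Y. soft_closed E' Y \<rho> H \<longrightarrow> soft_closed E X d (?inv H)"
  let ?C4 = "\<forall>F\<in>soft_sets E X. soft_subset E' (soft_image E E' f \<phi> (soft_closure E X d F))
    (soft_closure E' Y \<rho> (soft_image E E' f \<phi> F))"
  let ?C5 = "\<forall>G\<in>soft_sets E' Y. soft_subset E (soft_closure E X d (?inv G))
    (?inv (soft_closure E' Y \<rho> G))"
  let ?C6 = "\<forall>G\<in>soft_sets E' Y. soft_subset E (?inv (soft_interior E' Y \<rho> G))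
    (soft_interior E X d (?inv G))"
  \<comment> \<open>Soft openness includes being a soft set over \<open>Y\<close>, so bounding the
    quantifier by \<open>soft_sets E' Y\<close> does not change the condition.\<close>
  have c12: "?C1 \<longleftrightarrow> ?C2"
    using soft_continuous_iff_open_vimage[OF assms] soft_open_in_sets by blast
  have c23: "?C2 \<longleftrightarrow> ?C3"
  proof (intro iffI ballI impI)
    fix H assume ?C2 and "soft_closed E' Y \<rho> H"
    then show "soft_closed E X d (?inv H)"
      by (auto simp: soft_closed_def soft_vimage_in_sets soft_compl_in_sets
          soft_vimage_compl[OF map, symmetric])
  next
    fix G assume c3: ?C3 and G: "G \<in> soft_sets E' Y" "soft_open E' Y \<rho> G"
    \<comment> \<open>Condition (3) is applied to the complement of \<open>G\<close>, which is
      closed because its own complement is \<open>G\<close> again.\<close>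
    then have "soft_closed E X d (?inv (soft_compl E' Y G))"
      by (simp add: soft_compl_in_sets soft_closed_compl_iff)
    then show "soft_open E X d (?inv G)"
      by (simp add: soft_vimage_compl[OF map] soft_closed_compl_iff soft_vimage_in_sets)
  qed
  \<comment> \<open>The inverse image of the closure of \<open>G\<close> is closed by (3) and
    contains the inverse image of \<open>G\<close>; minimality of the closure finishes.\<close>
  have c35: ?C5 if ?C3
  proof
    fix G assume "G \<in> soft_sets E' Y"
    then have "soft_closed E' Y \<rho> (soft_closure E' Y \<rho> G)" by (rule soft_closed_closure)
    then have "soft_closed E X d (?inv (soft_closure E' Y \<rho> G))"
      using that soft_closed_in_sets by blast
    then show "soft_subset E (soft_closure E X d (?inv G)) (?inv (soft_closure E' Y \<rho> G))"
      by (intro soft_closure_minimal soft_vimage_mono[OF map] soft_subset_closure)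
  qed
  \<comment> \<open>Condition (5) is used at the image of \<open>F\<close>, whose inverse image
    contains \<open>F\<close> by the adjunction; transposing the resulting inclusion gives
    (4).\<close>
  have c54: ?C4 if ?C5
  proof
    fix F assume F: "F \<in> soft_sets E X"
    let ?fF = "soft_image E E' f \<phi> F"
    have "soft_subset E F (?inv ?fF)"
      using soft_image_subset_iff[OF map F] soft_subset_refl by blast
    then have "soft_subset E (soft_closure E X d F) (soft_closure E X d (?inv ?fF))"
      by (intro soft_closure_mono soft_vimage_in_sets)
    then have "soft_subset E (soft_closure E X d F) (?inv (soft_closure E' Y \<rho> ?fF))"
      using that soft_image_in_sets[OF map F] soft_subset_trans by blast
    then show "soft_subset E' (soft_image E E' f \<phi> (soft_closure E X d F)) (soft_closure E' Y \<rho> ?fF)"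
      using soft_image_subset_iff[OF map soft_closed_in_sets[OF soft_closed_closure[OF F]]] by blast
  qed
  \<comment> \<open>Condition (4) is used at the inverse image of \<open>H\<close>, whose image lies
    in \<open>H\<close> by the adjunction. As \<open>H\<close> is closed, transposing puts the
    closure of \<open>?inv H\<close> inside \<open>?inv H\<close>.\<close>
  have c43: ?C3 if ?C4
  proof (intro ballI impI)
    fix H assume "soft_closed E' Y \<rho> H"
    moreover have "soft_subset E' (soft_image E E' f \<phi> (?inv H)) H"
      using soft_image_subset_iff[OF map soft_vimage_in_sets] soft_subset_refl by blast
    ultimately have "soft_subset E' (soft_closure E' Y \<rho> (soft_image E E' f \<phi> (?inv H))) H"
      by (rule soft_closure_minimal)
    then have "soft_subset E' (soft_image E E' f \<phi> (soft_closure E X d (?inv H))) H"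
      using that soft_vimage_in_sets soft_subset_trans by blast
    then have "soft_subset E (soft_closure E X d (?inv H)) (?inv H)"
      using soft_image_subset_iff[OF map
          soft_closed_in_sets[OF soft_closed_closure[OF soft_vimage_in_sets]]] by blast
    then show "soft_closed E X d (?inv H)"
      by (intro soft_closed_if_closure_subset soft_vimage_in_sets)
  qed
  have c26: "?C2 \<longleftrightarrow> ?C6"
  proof (intro iffI ballI impI)
    fix G assume ?C2
    \<comment> \<open>The interior of \<open>G\<close> is open, so by (2) its inverse image is an
      open set inside \<open>?inv G\<close>, and the interior is the largest such set.\<close>
    then have "soft_open E X d (?inv (soft_interior E' Y \<rho> G))"
      using soft_open_interior soft_open_in_sets by blast
    then show "soft_subset E (?inv (soft_interior E' Y \<rho> G)) (soft_interior E X d (?inv G))"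
      by (intro soft_interior_maximal soft_vimage_mono[OF map] soft_interior_subset)
  next
    fix G assume ?C6 and G: "G \<in> soft_sets E' Y" "soft_open E' Y \<rho> G"
    \<comment> \<open>An open \<open>G\<close> is its own interior, so (6) gives the nontrivial half
      of the equality of \<open>?inv G\<close> with its interior.\<close>
    then have "soft_subset E (?inv G) (soft_interior E X d (?inv G))"
      by (metis soft_interior_eq)
    then have "soft_interior E X d (?inv G) = ?inv G"
      by (intro soft_sets_eqI[of _ E X] soft_interior_subset soft_vimage_in_sets
          soft_open_in_sets[OF soft_open_interior])
    then show "soft_open E X d (?inv G)" by (metis soft_open_interior)
  qed
  have c3: "?C1 \<longleftrightarrow> ?C3" using c12 c23 by (rule trans)
  have c4: "?C1 \<longleftrightarrow> ?C4" using c3 c35 c54 c43 by argo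
  have c5: "?C1 \<longleftrightarrow> ?C5" using c3 c35 c54 c43 by argo
  have c6: "?C1 \<longleftrightarrow> ?C6" using c12 c26 by (rule trans)
  show ?thesis by (intro conjI c12 c3 c4 c5 c6)
qed

end
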